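(* Let $p>0$, $\nu\ge0$, let $\kappa,\mu$ be real with $\mu\pm\kappa+\frac12>0$, let $x>0$ and let $n$ be a non-negative integer. Then the following lower bound holds: $$M_{\kappa,\mu}^{(p,\nu)}(x)>x^{\mu+\frac12}e^{-x/2}\sum_{j=0}^n\frac{x^j}{j!}\,\frac{B_{p,\nu}(\mu-\kappa+j+\frac12,\,\mu+\kappa+\frac12)}{B(\mu-\kappa+\frac12,\,\mu+\kappa+\frac12)}.$$
   Context: $B(x,y)=\Gamma(x)\Gamma(y)/\Gamma(x+y)$ is the Beta function, and $K_\lambda$ is the modified Bessel function of the second kind. For $\Re(p)>0$, $\nu\ge 0$, the extended Beta function is $$B_{p,\nu}(x,y)=\sqrt{\frac{2p}{\pi}}\int_0^1 t^{x-\frac32}(1-t)^{y-\frac32}K_{\nu+\frac12}\left(\frac{p}{t(1-t)}\right)dt.$$ The $(p,\nu)$-extended confluent hypergeometric function is $$\Phi_{p,\nu}(b;c;z)=\sum_{m=0}^\infty\frac{B_{p,\nu}(b+m,c-b)}{B(b,c-b)}\frac{z^m}{m!}=\frac{1}{B(b,c-b)}\sqrt{\frac{2p}{\pi}}\int_0^1t^{b-\frac32}(1-t)^{c-b-\frac32}e^{zt}K_{\nu+\frac12}\left(\frac{p}{t(1-t)}\right)dt.$$ The $(p,\nu)$-extended Whittaker function is $$M_{\kappa,\mu}^{(p,\nu)}(z)=z^{\mu+\frac12}e^{-z/2}\,\Phi_{p,\nu}(\mu-\kappa+\tfrac12;2\mu+1;z).$$ *)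

theory Defs
  imports "HOL-Probability.Probability" "HOL-Real_Asymp.Real_Asymp"
begin

text \<open>Everything is specialised to real parameters and a positive real argument, where all the
  powers occurring are principal ones.\<close>

text \<open>The modified Bessel function of the second kind of real order at \<open>x > 0\<close>, by its
  classical integral representation. The facts \<open>Bessel_K_ODE\<close> and \<open>Bessel_K_asymp\<close> below identify
  it: it is the solution of the modified Bessel equation of order \<open>\<alpha>\<close> on the positive half-line
  that is asymptotic to \<open>sqrt (pi / (2 * x)) * exp (- x)\<close>.\<close>

definition Bessel_K :: "real \<Rightarrow> real \<Rightarrow> real" where
  "Bessel_K \<alpha> x = (LINT t:{0..}|lborel. exp (- x * cosh t) * cosh (\<alpha> * t))"

definition ext_Beta :: "real \<Rightarrow> real \<Rightarrow> real \<Rightarrow> real \<Rightarrow> real" where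
  "ext_Beta p \<nu> x y = sqrt (2 * p / pi) *
     (LINT t:{0<..<1}|lborel. t powr (x - 3/2) * (1 - t) powr (y - 3/2)
        * Bessel_K (\<nu> + 1/2) (p / (t * (1 - t))))"

definition ext_Phi :: "real \<Rightarrow> real \<Rightarrow> real \<Rightarrow> real \<Rightarrow> real \<Rightarrow> real" where
  "ext_Phi p \<nu> b c z =
     (\<Sum>m. ext_Beta p \<nu> (b + real m) (c - b) / Beta b (c - b) * (z ^ m / fact m))"

definition ext_Whittaker_M :: "real \<Rightarrow> real \<Rightarrow> real \<Rightarrow> real \<Rightarrow> real \<Rightarrow> real" where
  "ext_Whittaker_M p \<nu> \<kappa> \<mu> z =
     z powr (\<mu> + 1/2) * exp (- z / 2) * ext_Phi p \<nu> (\<mu> - \<kappa> + 1/2) (2 * \<mu> + 1) z"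

text \<open>The functions \<open>Bessel_K_moment k\<close> are, up to sign, the derivatives of \<open>Bessel_K\<close>.\<close>

definition Bessel_K_moment :: "nat \<Rightarrow> real \<Rightarrow> real \<Rightarrow> real" where
  "Bessel_K_moment k \<alpha> x = (LINT t:{0..}|lborel. cosh t ^ k * (exp (- x * cosh t) * cosh (\<alpha> * t)))"

lemma cosh_exp_bounds:
  fixes t :: real assumes "t \<ge> 0"
  shows "exp t / 2 \<le> cosh t" "cosh t \<le> exp t" "cosh (a * t) \<le> exp (\<bar>a\<bar> * t)"
  "0 \<le> sinh t" "sinh t \<le> exp t" "\<bar>sinh (a * t)\<bar> \<le> exp (\<bar>a\<bar> * t)"
proof -
  have avg: "\<And>x y::real. (x + y) /\<^sub>R 2 = (x + y) / 2" "\<And>x y::real. (x - y) /\<^sub>R 2 = (x - y) / 2"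
    by simp_all
  define u v where uv: "u = exp t" "v = exp (- t)"
  have *: "v \<le> u" "0 < v" unfolding uv using assms by simp_all
  have ch: "cosh t = (u + v) / 2" "sinh t = (u - v) / 2" by (simp_all add: cosh_def sinh_def uv)
  show "exp t / 2 \<le> cosh t" "cosh t \<le> exp t" "0 \<le> sinh t" "sinh t \<le> exp t"
    unfolding ch uv(1)[symmetric] using * by (auto simp: field_simps)
  have "a * t \<le> \<bar>a\<bar> * t" "- (a * t) \<le> \<bar>a\<bar> * t"
    using assms mult_right_mono[of a "\<bar>a\<bar>" t] mult_right_mono[of "-a" "\<bar>a\<bar>" t] by simp_all
  moreover define u v w where uvw: "u = exp (a * t)" "v = exp (- (a * t))" "w = exp (\<bar>a\<bar> * t)"
  ultimately have **: "u \<le> w" "v \<le> w" "0 < u" "0 < v"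
    by simp_all
  have ch: "cosh (a * t) = (u + v) / 2" "sinh (a * t) = (u - v) / 2" by (simp_all add: cosh_def sinh_def uvw)
  show "cosh (a * t) \<le> exp (\<bar>a\<bar> * t)" "\<bar>sinh (a * t)\<bar> \<le> exp (\<bar>a\<bar> * t)"
    unfolding ch uvw(3)[symmetric] using ** by (auto simp: abs_le_iff)
qed

lemma exp_exp_bound:
  fixes x a :: real assumes "x > 0"
  shows "\<exists>C. \<forall>t\<ge>0. exp (a * t) * exp (- x * cosh t) \<le> C * exp (- t)"
proof -
  obtain N :: nat where N: "a + 1 \<le> real N" using real_arch_simple by blast
  have "exp (a * t) * exp (- x * cosh t) \<le> (fact N / (x / 2) ^ N) * exp (- t)" if t: "t \<ge> 0" for t
  proof -
    define y where "y = x * exp t / 2"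
    have y: "y \<ge> 0" using assms by (simp add: y_def)
    have "y ^ N / fact N \<le> exp y"
    proof -
      have "sum (\<lambda>n. y ^ n /\<^sub>R fact n) {N} \<le> exp y"
        unfolding exp_def using y by (intro sum_le_suminf summable_exp_generic) auto
      thus ?thesis by (simp add: divide_inverse mult.commute)
    qed
    moreover have "y \<le> x * cosh t" using mult_left_mono[OF cosh_exp_bounds(1)[OF t], of x] assms
      by (simp add: y_def)
    hence "exp y \<le> exp (x * cosh t)" by (simp only: exp_le_cancel_iff)
    ultimately have "y ^ N / fact N \<le> exp (x * cosh t)" by (rule order_trans)
    hence "y ^ N \<le> fact N * exp (x * cosh t)" by (simp add: divide_le_eq mult.commute)
    moreover have "y ^ N = exp t ^ N * (x / 2) ^ N" unfolding y_def by (simp add: power_mult_distrib[symmetric] mult.commute)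
    ultimately have 1: "exp t ^ N \<le> fact N / (x / 2) ^ N * exp (x * cosh t)"
      using assms by (simp add: le_divide_eq)
    have "exp ((a+1) * t) \<le> exp (real N * t)" using N t by (simp add: mult_right_mono)
    also have "\<dots> = exp t ^ N" by (simp add: exp_of_nat_mult)
    finally have 2: "exp ((a+1) * t) \<le> fact N / (x / 2) ^ N * exp (x * cosh t)" using 1 by simp
    have "exp (a * t) * exp (- x * cosh t) = exp ((a+1) * t) * (exp (- x * cosh t) * exp (- t))"
      by (simp add: exp_add[symmetric] algebra_simps)
    also have "\<dots> \<le> (fact N / (x / 2) ^ N * exp (x * cosh t)) * (exp (- x * cosh t) * exp (- t))"
      by (intro mult_right_mono[OF 2]) simp
    also have "\<dots> = fact N / (x / 2) ^ N * (exp (x * cosh t) * exp (- x * cosh t)) * exp (- t)"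
      by (simp only: mult_ac)
    also have "exp (x * cosh t) * exp (- x * cosh t) = 1" by (simp add: exp_add[symmetric])
    finally show ?thesis by simp
  qed
  thus ?thesis by blast
qed

lemma Bessel_K_aux_integrable:
  fixes x a :: real assumes "x > 0" and [measurable]: "f \<in> borel_measurable borel"
  and f: "\<And>t. t \<ge> 0 \<Longrightarrow> \<bar>f t\<bar> \<le> exp (a * t) * exp (- x * cosh t)"
  shows "set_integrable lborel {0..} f"
proof -
  obtain C where C: "\<And>t. t \<ge> 0 \<Longrightarrow> exp (a * t) * exp (- x * cosh t) \<le> C * exp (- t)"
    using exp_exp_bound[OF assms(1)] by blast
  have "set_integrable lborel {0..} (\<lambda>t::real. C * exp (- t))"
    using has_bochner_integral_I0i_power_exp_m'[of 0]
    by (intro set_integrable_mult_right) (auto simp: has_bochner_integral_iff set_integrable_def mult.commute)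
  thus ?thesis unfolding set_integrable_def
  proof (rule Bochner_Integration.integrable_bound)
    show "(\<lambda>x. indicat_real {0..} x *\<^sub>R f x) \<in> borel_measurable lborel" by measurable
    show "AE x in lborel. norm (indicat_real {0..} x *\<^sub>R f x) \<le> norm (indicat_real {0..} x *\<^sub>R (C * exp (- x)))"
      by (rule AE_I2) (use order_trans[OF order_trans[OF f C] abs_ge_self] in \<open>auto simp: indicator_def\<close>)
  qed
qed

lemma Bessel_term_bound:
  fixes t x \<alpha> :: real assumes t: "t \<ge> 0"
  shows "\<bar>cosh t ^ k * (exp (- x * cosh t) * cosh (\<alpha> * t))\<bar> \<le> exp ((real k + \<bar>\<alpha>\<bar>) * t) * exp (- x * cosh t)"
proof -
  have "cosh t ^ k * cosh (\<alpha> * t) \<le> exp t ^ k * exp (\<bar>\<alpha>\<bar> * t)"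
    using cosh_exp_bounds[OF t] by (intro mult_mono power_mono) auto
  also have "\<dots> = exp ((real k + \<bar>\<alpha>\<bar>) * t)" by (simp add: exp_of_nat_mult[symmetric] exp_add[symmetric] algebra_simps)
  finally have "(cosh t ^ k * cosh (\<alpha> * t)) * exp (- x * cosh t) \<le> exp ((real k + \<bar>\<alpha>\<bar>) * t) * exp (- x * cosh t)"
    by (rule mult_right_mono) (rule exp_ge_zero)
  moreover have "\<bar>cosh t ^ k * (exp (- x * cosh t) * cosh (\<alpha> * t))\<bar> = (cosh t ^ k * cosh (\<alpha> * t)) * exp (- x * cosh t)"
    by (simp only: abs_mult power_abs abs_of_nonneg[OF cosh_real_nonneg] abs_exp_cancel mult_ac)
  ultimately show ?thesis by (simp only:)
qed

lemma Bessel_K_moment_integrable: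
  fixes x \<alpha> :: real assumes "x > 0"
  shows "set_integrable lborel {0..} (\<lambda>t::real. cosh t ^ k * (exp (- x * cosh t) * cosh (\<alpha> * t)))"
proof (rule Bessel_K_aux_integrable[OF assms])
  show "(\<lambda>t::real. cosh t ^ k * (exp (- x * cosh t) * cosh (\<alpha> * t))) \<in> borel_measurable borel"
    by (intro borel_measurable_continuous_onI continuous_intros)
qed (rule Bessel_term_bound)

lemma Bessel_K_moment_deriv:
  assumes x: "x > 0"
  shows "(Bessel_K_moment k \<alpha> has_real_derivative - Bessel_K_moment (Suc k) \<alpha> x) (at x)"
  unfolding has_field_derivative_iff tendsto_at_iff_sequentially
proof (intro allI impI)
  fix X :: "nat \<Rightarrow> real" assume X: "\<forall>i. X i \<in> UNIV - {x}" "X \<longlonglongrightarrow> x"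
  define f where "f = (\<lambda>y t::real. cosh t ^ k * (exp (- y * cosh t) * cosh (\<alpha> * t)))"
  define g where "g = (\<lambda>t::real. cosh t ^ Suc k * (exp (- x * cosh t) * cosh (\<alpha> * t)))"
  have "eventually (\<lambda>i. X i > x/2) sequentially" using X(2) x
    by (intro order_tendstoD(1)[of X x]) auto
  then obtain N where N: "\<And>i. i \<ge> N \<Longrightarrow> X i > x/2" by (auto simp: eventually_sequentially)
  let ?q = "\<lambda>i t. (f (X (i+N)) t - f x t) / (X (i+N) - x)"
  have fint: "set_integrable lborel {0..} (f y)" if "y > 0" for y
    unfolding f_def by (rule Bessel_K_moment_integrable[OF that])
  have mf [measurable]: "f y \<in> borel_measurable borel" for y
    unfolding f_def by (intro borel_measurable_continuous_onI continuous_intros)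
  have mg [measurable]: "g \<in> borel_measurable borel"
    unfolding g_def by (intro borel_measurable_continuous_onI continuous_intros)
  have bint: "set_integrable lborel {0..} (\<lambda>t. cosh t ^ Suc k * (exp (- (x/2) * cosh t) * cosh (\<alpha> * t)))"
    by (rule Bessel_K_moment_integrable) (use x in auto)
  have der: "((\<lambda>y. f y t) has_real_derivative - (cosh t ^ Suc k * (exp (- y * cosh t) * cosh (\<alpha> * t)))) (at y)" for y t
    unfolding f_def by (auto intro!: derivative_eq_intros simp: algebra_simps)
  have "(\<lambda>i. LINT t:{0..}|lborel. ?q i t) \<longlonglongrightarrow> (LINT t:{0..}|lborel. - g t)"
    unfolding set_lebesgue_integral_def
  proof (rule integral_dominated_convergence[OF _ _ bint[unfolded set_integrable_def]])
    show "(\<lambda>x. indicat_real {0..} x *\<^sub>R - g x) \<in> borel_measurable lborel" by measurable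
    show "(\<lambda>x. indicat_real {0..} x *\<^sub>R ?q i x) \<in> borel_measurable lborel" for i by measurable
    show "AE t in lborel. (\<lambda>i. indicat_real {0..} t *\<^sub>R ?q i t) \<longlonglongrightarrow> indicat_real {0..} t *\<^sub>R - g t"
    proof (rule AE_I2, rule tendsto_scaleR[OF tendsto_const])
      fix t
      have "((\<lambda>y. (f y t - f x t) / (y - x)) \<longlongrightarrow> - g t) (at x)"
        using der[where y=x and t=t] unfolding has_field_derivative_iff g_def .
      from this[unfolded tendsto_at_iff_sequentially, rule_format, OF _ X(2)] X(1)
      show "(\<lambda>i. ?q i t) \<longlonglongrightarrow> - g t" unfolding o_def
        by (intro LIMSEQ_ignore_initial_segment[where f = "\<lambda>i. (f (X i) t - f x t) / (X i - x)"]) auto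
    qed
    show "AE t in lborel. norm (indicat_real {0..} t *\<^sub>R ?q i t) \<le> indicat_real {0..} t *\<^sub>R (cosh t ^ Suc k * (exp (- (x/2) * cosh t) * cosh (\<alpha> * t)))" for i
    proof (rule AE_I2)
      fix t :: real
      let ?B = "cosh t ^ Suc k * (exp (- (x/2) * cosh t) * cosh (\<alpha> * t))"
      have "norm (f (X (i+N)) t - f x t) \<le> ?B * norm (X (i+N) - x)"
      proof (rule field_differentiable_bound[where S = "{x/2<..}"])
        show "((\<lambda>y. f y t) has_real_derivative - (cosh t ^ Suc k * (exp (- y * cosh t) * cosh (\<alpha> * t)))) (at y within {x/2<..})" for y
          using der by (rule has_field_derivative_at_within)
        show "norm (- (cosh t ^ Suc k * (exp (- y * cosh t) * cosh (\<alpha> * t)))) \<le> ?B" if "y \<in> {x/2<..}" for y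
          using that by (auto simp: abs_mult intro!: mult_left_mono mult_right_mono)
      qed (use N[of "i+N"] x in auto)
      moreover have "X (i+N) \<noteq> x" using X(1) by auto
      ultimately have "norm (?q i t) \<le> ?B" by (simp add: norm_divide divide_le_eq)
      thus "norm (indicat_real {0..} t *\<^sub>R ?q i t) \<le> indicat_real {0..} t *\<^sub>R ?B"
        by (auto simp: indicator_def)
    qed
  qed
  moreover have "(LINT t:{0..}|lborel. - g t) = - Bessel_K_moment (Suc k) \<alpha> x"
    unfolding Bessel_K_moment_def g_def by (simp add: set_lebesgue_integral_def)
  moreover have "(LINT t:{0..}|lborel. ?q i t) = (Bessel_K_moment k \<alpha> (X (i+N)) - Bessel_K_moment k \<alpha> x) / (X (i+N) - x)" for i
  proof -
    have "X (i+N) > 0" using N[of "i+N"] x by auto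
    hence "(LINT t:{0..}|lborel. f (X (i+N)) t - f x t) = Bessel_K_moment k \<alpha> (X (i+N)) - Bessel_K_moment k \<alpha> x"
      using set_integral_diff(2)[OF fint fint, of "X (i+N)" x] x
      by (simp only: Bessel_K_moment_def f_def)
    thus ?thesis by simp
  qed
  ultimately have "(\<lambda>i. (Bessel_K_moment k \<alpha> (X (i+N)) - Bessel_K_moment k \<alpha> x) / (X (i+N) - x)) \<longlonglongrightarrow> - Bessel_K_moment (Suc k) \<alpha> x"
    by (simp only:)
  thus "((\<lambda>y. (Bessel_K_moment k \<alpha> y - Bessel_K_moment k \<alpha> x) / (y - x)) \<circ> X) \<longlonglongrightarrow> - Bessel_K_moment (Suc k) \<alpha> x"
    unfolding o_def by (rule LIMSEQ_offset)
qed

lemma Bessel_K_moment_relation: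
  assumes x: "x > 0"
  shows "x\<^sup>2 * Bessel_K_moment 2 \<alpha> x - x * Bessel_K_moment 1 \<alpha> x - (x\<^sup>2 + \<alpha>\<^sup>2) * Bessel_K_moment 0 \<alpha> x = 0"
proof -
  define F where "F = (\<lambda>t. - exp (- x * cosh t) * (x * sinh t * cosh (\<alpha> * t) + \<alpha> * sinh (\<alpha> * t)))"
  let ?T = "\<lambda>k t. cosh t ^ k * (exp (- x * cosh t) * cosh (\<alpha> * t))"
  let ?f = "\<lambda>t. x\<^sup>2 * ?T 2 t - x * ?T 1 t - (x\<^sup>2 + \<alpha>\<^sup>2) * ?T 0 t"
  note int = Bessel_K_moment_integrable[OF x, of _ \<alpha>]
  have fint: "set_integrable lborel {0..} ?f"
    by (intro set_integral_diff(1) set_integrable_mult_right int)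
  have val: "(LINT t:{0..}|lborel. ?f t) = x\<^sup>2 * Bessel_K_moment 2 \<alpha> x - x * Bessel_K_moment 1 \<alpha> x - (x\<^sup>2 + \<alpha>\<^sup>2) * Bessel_K_moment 0 \<alpha> x"
    unfolding Bessel_K_moment_def
    by (subst set_integral_diff(2), (intro set_integral_diff(1) set_integrable_mult_right int)+)+
      (simp only: set_integral_mult_right)
  have der: "(F has_real_derivative ?f t) (at t)" for t
    unfolding F_def by (auto intro!: derivative_eq_intros simp: algebra_simps power2_eq_square)
      (use cosh_square_eq[of t] in \<open>simp add: algebra_simps power2_eq_square; algebra\<close>)
  have cont: "continuous_on UNIV ?f" by (intro continuous_intros)
  have "(LINT t:{0..b}|lborel. ?f t) = F b" if "b \<ge> 0" for b
  proof -
    have "(LINT t:{0..b}|lborel. ?f t) = F b - F 0"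
      unfolding set_lebesgue_integral_def
      using that der cont
      by (intro integral_FTC_atLeastAtMost)
        (auto simp: has_real_derivative_iff_has_vector_derivative[symmetric] intro: has_field_derivative_at_within continuous_on_subset)
    thus ?thesis by (simp add: F_def)
  qed
  moreover have "((\<lambda>b. LINT t:{0..b}|lborel. ?f t) \<longlongrightarrow> (LINT t:{0..}|lborel. ?f t)) at_top"
    by (rule tendsto_set_lebesgue_integral_at_top[OF _ fint]) auto
  ultimately have "(F \<longlongrightarrow> (LINT t:{0..}|lborel. ?f t)) at_top"
    by (elim Lim_transform_eventually) (auto intro: eventually_mono[OF eventually_ge_at_top[of 0]])
  moreover have "(F \<longlongrightarrow> 0) at_top"
  proof -
    obtain C where C: "\<And>t. t \<ge> 0 \<Longrightarrow> exp ((1 + \<bar>\<alpha>\<bar>) * t) * exp (- x * cosh t) \<le> C * exp (- t)"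
      using exp_exp_bound[OF assms(1)] by blast
    have "norm (F t) \<le> (x + \<bar>\<alpha>\<bar>) * (C * exp (- t))" if t: "t \<ge> 0" for t
    proof -
      have e: "exp ((1 + \<bar>\<alpha>\<bar>) * t) = exp t * exp (\<bar>\<alpha>\<bar> * t)" by (simp add: exp_add[symmetric] algebra_simps)
      have "\<bar>x * sinh t * cosh (\<alpha> * t) + \<alpha> * sinh (\<alpha> * t)\<bar> \<le> x * (sinh t * cosh (\<alpha> * t)) + \<bar>\<alpha>\<bar> * (1 * \<bar>sinh (\<alpha> * t)\<bar>)"
        using cosh_exp_bounds(4)[OF t] x abs_triangle_ineq[of "x * sinh t * cosh (\<alpha> * t)" "\<alpha> * sinh (\<alpha> * t)"]
        by (simp add: abs_mult)
      also have "\<dots> \<le> x * (exp t * exp (\<bar>\<alpha>\<bar> * t)) + \<bar>\<alpha>\<bar> * (exp t * exp (\<bar>\<alpha>\<bar> * t))"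
        using cosh_exp_bounds[OF t] x t by (intro add_mono mult_left_mono mult_mono) auto
      also have "\<dots> = (x + \<bar>\<alpha>\<bar>) * exp ((1 + \<bar>\<alpha>\<bar>) * t)" unfolding e by (simp add: algebra_simps)
      finally have "norm (F t) \<le> exp (- x * cosh t) * ((x + \<bar>\<alpha>\<bar>) * exp ((1 + \<bar>\<alpha>\<bar>) * t))"
        unfolding F_def by (simp add: abs_mult mult_left_mono)
      also have "\<dots> = (x + \<bar>\<alpha>\<bar>) * (exp ((1 + \<bar>\<alpha>\<bar>) * t) * exp (- x * cosh t))" by simp
      also have "\<dots> \<le> (x + \<bar>\<alpha>\<bar>) * (C * exp (- t))" using C[OF t] x by (intro mult_left_mono) auto
      finally show ?thesis .
    qed
    moreover have "((\<lambda>t. (x + \<bar>\<alpha>\<bar>) * (C * exp (- t))) \<longlongrightarrow> 0) at_top"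
      by real_asymp
    ultimately show ?thesis
      by (intro Lim_null_comparison[of F "\<lambda>t. (x + \<bar>\<alpha>\<bar>) * (C * exp (- t))"])
         (auto intro: eventually_mono[OF eventually_ge_at_top[of 0]])
  qed
  ultimately have "(LINT t:{0..}|lborel. ?f t) = 0"
    by (intro tendsto_unique[of at_top F]) auto
  thus ?thesis using val by simp
qed

lemma Bessel_K_J: "Bessel_K \<alpha> = Bessel_K_moment 0 \<alpha>"
  by (simp add: fun_eq_iff Bessel_K_def Bessel_K_moment_def)

lemma Bessel_K_ODE:
  "\<exists>K' K''. \<forall>x>0. (Bessel_K \<alpha> has_real_derivative K' x) (at x) \<and> (K' has_real_derivative K'' x) (at x)
     \<and> x\<^sup>2 * K'' x + x * K' x - (x\<^sup>2 + \<alpha>\<^sup>2) * Bessel_K \<alpha> x = 0"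
proof (intro exI allI impI conjI)
  fix x :: real assume x: "x > 0"
  show "(Bessel_K \<alpha> has_real_derivative (\<lambda>x. - Bessel_K_moment 1 \<alpha> x) x) (at x)"
    using Bessel_K_moment_deriv[OF x, of 0] by (simp add: Bessel_K_J)
  show "((\<lambda>x. - Bessel_K_moment 1 \<alpha> x) has_real_derivative Bessel_K_moment 2 \<alpha> x) (at x)"
    using DERIV_minus[OF Bessel_K_moment_deriv[OF x, of 1]] by (simp add: numeral_2_eq_2)
  show "x\<^sup>2 * Bessel_K_moment 2 \<alpha> x + x * (- Bessel_K_moment 1 \<alpha> x) - (x\<^sup>2 + \<alpha>\<^sup>2) * Bessel_K \<alpha> x = 0"
    using Bessel_K_moment_relation[OF x] by (simp add: Bessel_K_J)
qed

lemma cosh_ge_quad: "1 + t\<^sup>2 / 2 \<le> cosh (t::real)"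
proof -
  have "2 * (sinh (t/2))\<^sup>2 = cosh t - 1" using cosh_double[of "t/2"] cosh_square_eq[of "t/2"] by simp
  moreover have "\<bar>t/2\<bar> \<le> \<bar>sinh (t/2)\<bar>"
  proof -
    have "u \<le> sinh u" if "u \<ge> 0" for u :: real
      using DERIV_nonneg_imp_nondecreasing[OF that, of "\<lambda>u. sinh u - u"]
      by (force intro!: derivative_eq_intros exI cosh_real_ge_1)
    from this[of "t/2"] this[of "-t/2"] show ?thesis by (cases "t \<ge> 0") auto
  qed
  ultimately show ?thesis using power_mono[of "\<bar>t/2\<bar>" "\<bar>sinh (t/2)\<bar>" 2] by (simp add: power_divide)
qed

lemma Bessel_K_asymp: "Bessel_K \<alpha> \<sim>[at_top] (\<lambda>x. sqrt (pi / (2 * x)) * exp (- x))"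
proof -
  define h where "h = (\<lambda>x s. indicat_real {0..} s * (exp (- x * (cosh (s / sqrt x) - 1)) * cosh (\<alpha> * (s / sqrt x))))"
  define b where "b = (\<lambda>s::real. indicat_real {0..} s * (exp (- s\<^sup>2/2) * exp (\<bar>\<alpha>\<bar> * s)))"
  have mh: "h x \<in> borel_measurable borel" for x
    unfolding h_def divide_inverse
    by (intro borel_measurable_times borel_measurable_indicator borel_measurable_continuous_onI continuous_intros) auto
  have b: "integrable lborel b"
  proof -
    let ?E = "\<lambda>s::real. indicat_real {0..} s * (exp ((\<bar>\<alpha>\<bar> + 1)\<^sup>2 / 2) * exp (- s))"
    have "integrable lborel ?E"
      using has_bochner_integral_I0i_power_exp_m'[of 0]
        integrable_mult_right[of "exp ((\<bar>\<alpha>\<bar> + 1)\<^sup>2 / 2)" lborel "\<lambda>s. indicat_real {0..} s * exp (- s)"]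
      by (simp add: has_bochner_integral_iff mult_ac)
    thus ?thesis
    proof (rule Bochner_Integration.integrable_bound)
      show "b \<in> borel_measurable lborel" unfolding b_def by measurable
      have "- s\<^sup>2/2 + \<bar>\<alpha>\<bar> * s \<le> (\<bar>\<alpha>\<bar> + 1)\<^sup>2 / 2 + - s" for s
        using zero_le_power2[of "s - (\<bar>\<alpha>\<bar> + 1)"] by (simp add: power2_eq_square algebra_simps)
      thus "AE s in lborel. norm (b s) \<le> norm (?E s)"
        unfolding b_def by (intro AE_I2) (auto simp: indicator_def exp_add[symmetric] simp del: exp_le_cancel_iff intro!: exp_le_cancel_iff[THEN iffD2])
    qed
  qed
  have lim: "((\<lambda>x. integral\<^sup>L lborel (h x)) \<longlongrightarrow> integral\<^sup>L lborel (\<lambda>s. indicat_real {0..} s * exp (- s\<^sup>2/2))) at_top"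
  proof (rule integral_dominated_convergence_at_top[OF _ _ b])
    show "\<forall>\<^sub>F x in at_top. AE s in lborel. norm (h x s) \<le> b s"
    proof (rule eventually_mono[OF eventually_ge_at_top[of 1]], rule AE_I2)
      fix x s :: real assume x: "x \<ge> 1"
      have "exp (- x * (cosh (s / sqrt x) - 1)) * cosh (\<alpha> * (s / sqrt x)) \<le> exp (- s\<^sup>2/2) * exp (\<bar>\<alpha>\<bar> * s)" if s: "s \<ge> 0"
      proof (rule mult_mono)
        have "x * (s\<^sup>2 / x / 2) \<le> x * (cosh (s / sqrt x) - 1)"
          using cosh_ge_quad[of "s / sqrt x"] x by (intro mult_left_mono) (auto simp: power_divide)
        thus "exp (- x * (cosh (s / sqrt x) - 1)) \<le> exp (- s\<^sup>2/2)" using x by simp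
        have "cosh (\<alpha> * (s / sqrt x)) \<le> exp (\<bar>\<alpha>\<bar> * (s / sqrt x))"
          using s x by (intro cosh_exp_bounds) auto
        also have "\<dots> \<le> exp (\<bar>\<alpha>\<bar> * s)"
        proof -
          have "s / sqrt x \<le> s / 1" using s x by (intro divide_left_mono) auto
          hence "\<bar>\<alpha>\<bar> * (s / sqrt x) \<le> \<bar>\<alpha>\<bar> * s" by (intro mult_left_mono) auto
          thus ?thesis by (simp only: exp_le_cancel_iff)
        qed
        finally show "cosh (\<alpha> * (s / sqrt x)) \<le> exp (\<bar>\<alpha>\<bar> * s)" .
      qed auto
      thus "norm (h x s) \<le> b s" by (auto simp: h_def b_def indicator_def)
    qed
    show "AE s in lborel. ((\<lambda>x. h x s) \<longlongrightarrow> indicat_real {0..} s * exp (- s\<^sup>2/2)) at_top"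
    proof (rule AE_I2)
      fix s :: real
      have "((\<lambda>x. - x * (cosh (s / sqrt x) - 1)) \<longlongrightarrow> - s\<^sup>2 / 2) at_top"
        unfolding cosh_def by (cases s "0::real" rule: linorder_cases; simp; real_asymp simp: power2_eq_square)
      moreover have "((\<lambda>x. \<alpha> * (s / sqrt x)) \<longlongrightarrow> 0) at_top" by real_asymp
      hence "((\<lambda>x. cosh (\<alpha> * (s / sqrt x))) \<longlongrightarrow> 1) at_top"
        using tendsto_cosh[of "\<lambda>x. \<alpha> * (s / sqrt x)" 0 at_top] by simp
      ultimately have "((\<lambda>x. indicat_real {0..} s * (exp (- x * (cosh (s / sqrt x) - 1)) * cosh (\<alpha> * (s / sqrt x))))
          \<longlongrightarrow> indicat_real {0..} s * (exp (- s\<^sup>2 / 2) * 1)) at_top"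
        by (intro tendsto_mult tendsto_exp tendsto_const)
      thus "((\<lambda>x. h x s) \<longlongrightarrow> indicat_real {0..} s * exp (- s\<^sup>2/2)) at_top"
        unfolding h_def by (simp only: mult_1_right)
    qed
    show "(\<lambda>s. indicat_real {0..} s * exp (- s\<^sup>2/2)) \<in> borel_measurable lborel" by measurable
    show "h x \<in> borel_measurable lborel" for x using mh by simp
  qed
  have gauss: "integral\<^sup>L lborel (\<lambda>s. indicat_real {0..} s * exp (- s\<^sup>2/2)) = sqrt (pi / 2)"
  proof -
    have *: "indicat_real {0..} (sqrt 2 * s) = indicat_real {0..} s" for s by (auto simp: indicator_def zero_le_mult_iff)
    have "integral\<^sup>L lborel (\<lambda>s. indicat_real {0..} s * exp (- s\<^sup>2/2)) = sqrt 2 * (sqrt pi / 2)"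
      using gaussian_moment_0
      by (subst lborel_integral_real_affine[where t=0 and c="sqrt 2"]) (auto simp: * power_mult_distrib has_bochner_integral_iff)
    also have "\<dots> = sqrt (pi / 2)" by (simp add: real_sqrt_divide field_simps)
    finally show ?thesis .
  qed
  have "integral\<^sup>L lborel (h x) = sqrt x * exp x * Bessel_K \<alpha> x" if x: "x > 0" for x
  proof -
    have *: "indicat_real {0..} (s / sqrt x) = indicat_real {0..} s" for s using x by (auto simp: indicator_def zero_le_divide_iff)
    have "Bessel_K \<alpha> x = inverse (sqrt x) * (LINT s|lborel. indicat_real {0..} s * (exp (- x * cosh (s / sqrt x)) * cosh (\<alpha> * (s / sqrt x))))"
      unfolding Bessel_K_def set_lebesgue_integral_def
      using x by (subst lborel_integral_real_affine[where t=0 and c="inverse (sqrt x)"]) (auto simp: * field_simps)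
    also have "(\<lambda>s. indicat_real {0..} s * (exp (- x * cosh (s / sqrt x)) * cosh (\<alpha> * (s / sqrt x)))) = (\<lambda>s. exp (- x) * h x s)"
      unfolding h_def by (auto simp: fun_eq_iff right_diff_distrib exp_diff exp_minus field_simps)
    finally show ?thesis using x by (simp add: exp_minus field_simps)
  qed
  hence ev: "eventually (\<lambda>x. integral\<^sup>L lborel (h x) = sqrt x * exp x * Bessel_K \<alpha> x) at_top"
    by (intro eventually_mono[OF eventually_gt_at_top[of 0]]) auto
  have "((\<lambda>x. sqrt x * exp x * Bessel_K \<alpha> x) \<longlongrightarrow> sqrt (pi / 2)) at_top"
    by (rule Lim_transform_eventually[OF lim[unfolded gauss] ev])
  hence lim': "((\<lambda>x. sqrt x * exp x * Bessel_K \<alpha> x / sqrt (pi / 2)) \<longlongrightarrow> sqrt (pi / 2) / sqrt (pi / 2)) at_top"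
    by (intro tendsto_divide tendsto_const) auto
  have ev': "eventually (\<lambda>x. sqrt x * exp x * Bessel_K \<alpha> x / sqrt (pi / 2) =
      Bessel_K \<alpha> x / (sqrt (pi / (2 * x)) * exp (- x))) at_top"
    by (rule eventually_mono[OF eventually_gt_at_top[of 0]])
      (simp add: real_sqrt_divide real_sqrt_mult exp_minus field_simps)
  have "((\<lambda>x. Bessel_K \<alpha> x / (sqrt (pi / (2 * x)) * exp (- x))) \<longlongrightarrow> 1) at_top"
    using Lim_transform_eventually[OF lim' ev'] by simp
  thus ?thesis
    by (intro asymp_equivI')
qed

end

theory Submission
  imports Defs
begin

text \<open>Since \<open>K\<^sub>\<alpha>\<close> is positive and decays exponentially, every extended Beta value is a positive
  convergent integral, and it decreases when the first argument grows because \<open>t < 1\<close> in the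
  integrand. So the series of \<open>\<Phi>\<close> has positive terms and is dominated by a multiple of the
  exponential series; dropping its tail makes it strictly smaller.\<close>

text \<open>A nonnegative function with zero integral vanishes almost everywhere; as
  \<open>f\<close> is positive on \<open>A\<close>, this would make \<open>A\<close> a null
  set.\<close>

lemma set_integral_pos:
  fixes f :: "'a \<Rightarrow> real"
  assumes "set_integrable M A f" and "A \<in> sets M" and "emeasure M A \<noteq> 0"
    and pos: "\<And>t. t \<in> A \<Longrightarrow> f t > 0"
  shows "(LINT t:A|M. f t) > 0"
proof -
  let ?g = "\<lambda>t. indicat_real A t *\<^sub>R f t"
  have int: "integrable M ?g" using assms(1) by (simp add: set_integrable_def)
  have nonneg: "AE t in M. 0 \<le> ?g t"
    using pos by (intro AE_I2) (auto simp: indicator_def less_imp_le)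
  have "integral\<^sup>L M ?g \<noteq> 0"
  proof
    assume "integral\<^sup>L M ?g = 0"
    hence "AE t in M. ?g t = 0"
      using integral_nonneg_eq_0_iff_AE[OF int nonneg] by simp
    hence "AE t in M. t \<notin> A"
      by eventually_elim (use pos in \<open>force simp: indicator_def split: if_splits\<close>)
    moreover have "{t \<in> space M. \<not> t \<notin> A} = A" using sets.sets_into_space[OF assms(2)] by auto
    ultimately show False using assms(3) AE_iff_measurable[OF assms(2), of "\<lambda>t. t \<notin> A"] by simp
  qed
  moreover have "integral\<^sup>L M ?g \<ge> 0" using nonneg by (rule integral_nonneg_AE)
  ultimately show ?thesis by (simp add: set_lebesgue_integral_def)
qed

lemma Bessel_K_integrable:
  fixes x \<alpha> :: real
  assumes "x > 0"
  shows "set_integrable lborel {0..} (\<lambda>t. exp (- x * cosh t) * cosh (\<alpha> * t))"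
  using Bessel_K_moment_integrable[OF assms, of 0] by simp

lemma Bessel_K_pos:
  assumes "x > 0"
  shows "Bessel_K \<alpha> x > 0"
  unfolding Bessel_K_def
proof (rule set_integral_pos[OF Bessel_K_integrable[OF assms]])
  \<comment> \<open>The unit interval, of measure 1, already shows that the half-line is not
    null.\<close>
  have "emeasure lborel {0..1::real} \<le> emeasure lborel {0::real..}" by (intro emeasure_mono) auto
  thus "emeasure lborel {0::real..} \<noteq> 0" by auto
qed auto

lemma Bessel_K_continuous_on: "continuous_on {0<..} (Bessel_K \<alpha>)"
  unfolding Bessel_K_J using Bessel_K_moment_deriv
  by (intro continuous_at_imp_continuous_on) (auto intro: DERIV_isCont)

text \<open>Split \<open>x * cosh t\<close> into two halves: one is at least \<open>x / 2\<close>
  because \<open>cosh t\<close> \<ge> 1, the other at least \<open>a * cosh t\<close> because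
  \<open>a\<close> \<le> \<open>x / 2\<close>. What remains is the integrand of
  \<open>Bessel_K\<close> at \<open>a\<close>.\<close>

lemma Bessel_K_le_exp:
  assumes "a > 0" and "2 * a \<le> x"
  shows "Bessel_K \<alpha> x \<le> Bessel_K \<alpha> a * exp (- x / 2)"
proof -
  have "x > 0" using assms by simp
  have "(LINT t:{0..}|lborel. exp (- x * cosh t) * cosh (\<alpha> * t))
      \<le> (LINT t:{0..}|lborel. exp (- x / 2) * (exp (- a * cosh t) * cosh (\<alpha> * t)))"
  proof (rule set_integral_mono)
    fix t :: real
    have "x / 2 * 1 \<le> x / 2 * cosh t" "a * cosh t \<le> x / 2 * cosh t"
      using assms cosh_real_ge_1[of t] by (intro mult_left_mono mult_right_mono; simp)+
    hence "- x * cosh t \<le> - x / 2 + - a * cosh t" by linarith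
    hence "exp (- x * cosh t) \<le> exp (- x / 2) * exp (- a * cosh t)"
      unfolding exp_add[symmetric] by (simp only: exp_le_cancel_iff)
    thus "exp (- x * cosh t) * cosh (\<alpha> * t) \<le> exp (- x / 2) * (exp (- a * cosh t) * cosh (\<alpha> * t))"
      unfolding mult.assoc[symmetric] by (intro mult_right_mono) auto
  qed (intro set_integrable_mult_right Bessel_K_integrable assms \<open>x > 0\<close>)+
  thus ?thesis by (simp add: Bessel_K_def mult.commute)
qed

text \<open>The exponential series at \<open>y\<close> dominates its single term of index
  \<open>N\<close>; take reciprocals.\<close>

lemma exp_minus_le_inverse_power:
  fixes y :: real
  assumes "y > 0"
  shows "exp (- y) \<le> fact N / y ^ N"
proof -
  have "sum (\<lambda>n. y ^ n /\<^sub>R fact n) {N} \<le> exp y"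
    unfolding exp_def using assms by (intro sum_le_suminf summable_exp_generic) auto
  thus ?thesis using assms by (simp add: exp_minus field_simps)
qed

text \<open>The exponential decays at both end points faster than any power, so \<open>a\<close> and
  \<open>b\<close> may be arbitrarily negative.\<close>

lemma powr_times_exp_bounded:
  fixes a b c :: real
  assumes "c > 0"
  obtains C where "\<And>t. t \<in> {0<..<1} \<Longrightarrow> t powr a * (1 - t) powr b * exp (- c / (t * (1 - t))) \<le> C"
proof -
  \<comment> \<open>This \<open>N\<close> makes \<open>a + N\<close> and \<open>b + N\<close>
    nonnegative, so both powers end up at most 1.\<close>
  obtain N :: nat where N: "max (- a) (- b) \<le> real N" using real_arch_simple by blast
  have "t powr a * (1 - t) powr b * exp (- c / (t * (1 - t))) \<le> fact N / c ^ N"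
    if t: "t \<in> {0<..<1}" for t
  proof -
    have "exp (- (c / (t * (1 - t)))) \<le> fact N / (c / (t * (1 - t))) ^ N"
      using t assms by (intro exp_minus_le_inverse_power) auto
    hence "t powr a * (1 - t) powr b * exp (- c / (t * (1 - t)))
        \<le> t powr a * (1 - t) powr b * (fact N / (c / (t * (1 - t))) ^ N)"
      by (intro mult_left_mono) auto
    also have "\<dots> = (t powr a * t ^ N) * ((1 - t) powr b * (1 - t) ^ N) * (fact N / c ^ N)"
      by (simp add: power_divide power_mult_distrib)
    also have "\<dots> = t powr (a + real N) * (1 - t) powr (b + real N) * (fact N / c ^ N)"
      using t by (simp add: powr_add powr_realpow)
    also have "\<dots> \<le> 1 * 1 * (fact N / c ^ N)"
      using t N assms by (intro mult_right_mono mult_mono powr_le1) auto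
    finally show ?thesis by simp
  qed
  thus thesis using that by blast
qed

text \<open>The decay of \<open>Bessel_K\<close> outweighs any end-point singularity of the powers:
  the integrand is bounded on an interval of finite measure.\<close>

lemma ext_Beta_integrable:
  assumes p: "p > 0"
  shows "set_integrable lborel {0<..<1}
    (\<lambda>t. t powr a * (1 - t) powr b * Bessel_K \<alpha> (p / (t * (1 - t))))" (is "set_integrable _ ?S ?f")
proof -
  obtain C where C: "\<And>t. t \<in> ?S \<Longrightarrow>
      t powr a * (1 - t) powr b * exp (- (p / 2) / (t * (1 - t))) \<le> C"
    using powr_times_exp_bounded[of "p / 2" a b] p by auto
  define D where "D = Bessel_K \<alpha> (2 * p) * C"
  have D: "\<bar>?f t\<bar> \<le> D" if t: "t \<in> ?S" for t
  proof -
    have tt: "t * (1 - t) > 0" using t by simp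
    \<comment> \<open>Hence the Bessel argument is at least \<open>4 * p\<close>, the threshold of
      \<open>Bessel_K_le_exp\<close> for \<open>a = 2 * p\<close>.\<close>
    have "t * (1 - t) \<le> 1 / 4"
      using zero_le_power2[of "t - 1/2"] by (simp add: power2_eq_square algebra_simps)
    hence "p * (t * (1 - t)) \<le> p * (1 / 4)" using p by (intro mult_left_mono) auto
    hence "4 * p * (t * (1 - t)) \<le> p" by linarith
    hence le: "2 * (2 * p) \<le> p / (t * (1 - t))" using tt by (subst pos_le_divide_eq) auto
    have "0 < Bessel_K \<alpha> (p / (t * (1 - t)))"
      using p tt by (intro Bessel_K_pos) simp
    hence "\<bar>?f t\<bar> = ?f t" by (simp add: abs_mult)
    also have "\<dots> \<le> t powr a * (1 - t) powr b
        * (Bessel_K \<alpha> (2 * p) * exp (- (p / (t * (1 - t))) / 2))"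
      using p le by (intro mult_left_mono Bessel_K_le_exp) auto
    also have "\<dots> = Bessel_K \<alpha> (2 * p)
        * (t powr a * (1 - t) powr b * exp (- (p / 2) / (t * (1 - t))))"
      by (simp add: mult_ac)
    also have "\<dots> \<le> D" unfolding D_def
      using p by (intro mult_left_mono C t) (simp add: less_imp_le[OF Bessel_K_pos])
    finally show ?thesis .
  qed
  have "set_borel_measurable lborel ?S ?f"
  proof -
    \<comment> \<open>Continuity of \<open>Bessel_K\<close> is known on the positive half-line only,
      so measurability is derived on the open interval.\<close>
    have "continuous_on ?S (\<lambda>t. Bessel_K \<alpha> (p / (t * (1 - t))))"
      using p by (intro continuous_on_compose2[OF Bessel_K_continuous_on] continuous_intros) auto
    hence "continuous_on ?S ?f" by (intro continuous_intros) auto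
    from borel_measurable_continuous_on_indicator[OF _ this] show ?thesis
      by (simp add: set_borel_measurable_def)
  qed
  thus ?thesis
    by (rule set_integrable_bound[where f = "\<lambda>_. D", rotated])
       (use D in \<open>force simp: set_integrable_def intro!: AE_I2\<close>)+
qed

lemma ext_Beta_pos:
  assumes "p > 0"
  shows "ext_Beta p \<nu> x y > 0"
  unfolding ext_Beta_def
  by (intro mult_pos_pos set_integral_pos ext_Beta_integrable assms Bessel_K_pos)
     (use assms in auto)

lemma ext_Beta_mono:
  assumes "p > 0" and "x \<le> x'"
  shows "ext_Beta p \<nu> x' y \<le> ext_Beta p \<nu> x y"
  unfolding ext_Beta_def
proof (intro mult_left_mono set_integral_mono ext_Beta_integrable mult_right_mono assms(1))
  fix t :: real assume t: "t \<in> {0<..<1}"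
  thus "t powr (x' - 3/2) \<le> t powr (x - 3/2)"
    using assms(2) by (intro powr_mono') auto
  show "0 \<le> Bessel_K (\<nu> + 1/2) (p / (t * (1 - t)))"
    using t assms(1) by (intro less_imp_le[OF Bessel_K_pos]) auto
qed (use assms in auto)

theorem theorem7:
  fixes p \<nu> \<kappa> \<mu> x :: real and n :: nat
  assumes "p > 0" and "\<nu> \<ge> 0"
    and "\<mu> + \<kappa> + 1/2 > 0" and "\<mu> - \<kappa> + 1/2 > 0"
    and "x > 0"
  shows "ext_Whittaker_M p \<nu> \<kappa> \<mu> x >
    x powr (\<mu> + 1/2) * exp (- x / 2) *
      (\<Sum>j=0..n. x ^ j / fact j *
         (ext_Beta p \<nu> (\<mu> - \<kappa> + real j + 1/2) (\<mu> + \<kappa> + 1/2)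
            / Beta (\<mu> - \<kappa> + 1/2) (\<mu> + \<kappa> + 1/2)))"
proof -
  define b d where "b = \<mu> - \<kappa> + 1/2" and "d = \<mu> + \<kappa> + 1/2"
  \<comment> \<open>This matches the second Beta argument in \<open>ext_Phi\<close> with
    \<open>d\<close>.\<close>
  have cb: "2 * \<mu> + 1 - b = d" by (simp add: b_def d_def)
  have B: "Beta b d > 0"
    using assms by (auto simp: Beta_def b_def d_def intro!: divide_pos_pos mult_pos_pos Gamma_real_pos)
  define u where "u j = ext_Beta p \<nu> (b + real j) d / Beta b d * (x ^ j / fact j)" for j
  have upos: "u j > 0" for j
    unfolding u_def using B assms ext_Beta_pos by (intro mult_pos_pos divide_pos_pos) auto
  have "summable u"
  proof (rule summable_comparison_test')
    \<comment> \<open>The majorant freezes the first argument of \<open>ext_Beta\<close> at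
      \<open>b\<close>, its value for \<open>j = 0\<close>, leaving a multiple of the exponential
      series.\<close>
    show "summable (\<lambda>j. ext_Beta p \<nu> b d / Beta b d * (x ^ j / fact j))"
      using summable_exp[of x] by (intro summable_mult) (simp add: field_simps)
    show "norm (u j) \<le> ext_Beta p \<nu> b d / Beta b d * (x ^ j / fact j)" for j
    proof -
      have "u j \<le> ext_Beta p \<nu> b d / Beta b d * (x ^ j / fact j)"
        unfolding u_def using B assms by (intro mult_right_mono divide_right_mono ext_Beta_mono) auto
      thus ?thesis using upos[of j] by simp
    qed
  qed
  \<comment> \<open>Strict because every term from index \<open>Suc n\<close> on is
    positive.\<close>
  hence "sum u {..<Suc n} < suminf u" using upos by (intro sum_less_suminf) auto
  moreover have "suminf u = ext_Phi p \<nu> b (2 * \<mu> + 1) x"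
    unfolding ext_Phi_def cb u_def ..
  moreover have "sum u {..<Suc n} = (\<Sum>j=0..n. x ^ j / fact j *
      (ext_Beta p \<nu> (\<mu> - \<kappa> + real j + 1/2) d / Beta b d))"
    by (intro sum.cong) (auto simp: u_def b_def add_ac algebra_simps)
  ultimately show ?thesis
    unfolding ext_Whittaker_M_def b_def[symmetric] d_def[symmetric]
    using assms(5) by (intro mult_strict_left_mono) auto
qed

end
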